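(* Let $n>2$ be prime and $\zeta$ a primitive $n$-th root of unity, and consider the family of polynomial systems with parameters $a$ described in the context. There is a Poincaré–Dulac normal form $\dot{\mathbf{y}}=\mathcal{Z}\mathbf{y}+\sum_{j\ge2}G_j(\mathbf{y})$ of this system, where $\mathcal{Z}=\mathrm{diag}[1,\zeta,\dots,\zeta^{n-1}]$ and each component of $G_j$ is homogeneous of degree $j$ in $\mathbf{y}$, such that $$G_j(\mathbf{y})=\mathbf{y}^{\mathbf{K}}\,(\mathbf{y}\odot q(a)),$$ where $\mathbf{K}=(K,K,\dots,K)$, $q(a)=(q_1(a),\dots,q_n(a))^\top$ (with $K$ and $q$ depending on $j$, and $q$ possibly zero), and $q_i(a)\in R_{\mathbf{K}}$ for $i=1,\dots,n$.
   Context: $\mathbb{N}_0=\{0,1,2,\dots\}$ and $\mathbb{N}_{-1}=\mathbb{N}_0\cup\{-1\}$. $T_n$ is the cyclic permutation $T_n(p_1,\dots,p_n)=(p_n,p_1,\dots,p_{n-1})$. Fix $\ell\ge1$ and distinct vectors $\mathbf{p}^{(1)},\dots,\mathbf{p}^{(\ell)}\in\mathbb{N}_{-1}\times\mathbb{N}_0^{n-1}$ with $\sum_jp_j^{(k)}\ge1$ for all $k$. For a vector $\mathbf{p}$ write $\mathbf{x}^{\mathbf{p}}=x_1^{p_1}\cdots x_n^{p_n}$. The system is $$\dot x_j=x_j\Big(\zeta^{j-1}+\sum_{k=1}^{\ell}a^{(j)}_{T_n^{j-1}(\mathbf{p}^{(k)})}\,\mathbf{x}^{T_n^{j-1}(\mathbf{p}^{(k)})}\Big),\qquad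 j=1,\dots,n,$$ with $n\ell$ parameters $a^{(j)}_{T_n^{j-1}(\mathbf{p}^{(k)})}$, regarded as independent variables of the polynomial ring $\mathbb{Q}[a]$. For $\nu\in\mathbb{N}_0^{n\ell}$: $[\nu]=\prod_{k=1}^{\ell}\prod_{m=0}^{n-1}\big(a^{(m+1)}_{T_n^m(\mathbf{p}^{(k)})}\big)^{\nu_{(k-1)n+m+1}}$ and $L(\nu)=\sum_{k=1}^{\ell}\sum_{m=0}^{n-1}\nu_{(k-1)n+m+1}\,T_n^m(\mathbf{p}^{(k)})\in\mathbb{Z}^n$. For $m\in\mathbb{Z}^n$, $R_m$ is the subset of $\mathbb{Q}[a]$ consisting of all $m$-polynomials, i.e. of all polynomials in the parameters $a$ with rational coefficients, all of whose monomials $[\nu]$ (with nonzero coefficient) satisfy $L(\nu)=m$. $\odot$ is the componentwise (Hadamard) product, $\mathbf{y}^{\mathbf{K}}=y_1^Ky_2^K\cdots y_n^K$. Normal form: a formal change of coordinates $\mathbf{x}=\mathbf{y}+\sum_{j\ge2}H_j(\mathbf{y})$, with each $H_j$ a vector of homogeneous polynomials of degree $j$, brings the system to the form $\dot{\mathbf{y}}=\mathcal{Z}\mathbf{y}+\sum_{j\ge2}G_j(\mathbf{y})$. The latter is a (Poincaré–Dulac) normal form of the system if every monomial $\mathbf{y}^\alpha$ ($\alpha\in\mathbb{N}_0^n$, $|\alpha|\ge2$) occurring with nonzero coefficient in the $k$-th component of $\sum_jG_j$ is resonant, i.e. $\sum_{i=1}^n\alpha_i\zeta^{i-1}-\ze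ta^{k-1}=0$.
   Formalization: The q_i(a) are K-polynomials with coefficients in Q(ζ) rather than Q; with rational coefficients the claim is false, e.g. n=3, p^(1)=(1,0,0), p^(2)=(0,1,1), where q_2 in degree 4 contains a monomial with coefficient -1/ζ. *)

theory Defs
  imports
    "HOL-Library.Poly_Mapping"
    "HOL-Computational_Algebra.Computational_Algebra"
    Complex_Main
begin

text \<open>
  Conventions. Indices are 0-based: the coordinates are \<open>x_0, ..., x_(n-1)\<close>, so the eigenvalue of
  coordinate \<open>i\<close> is \<open>\<zeta> ^ i\<close>. A vector is a function on \<open>nat\<close> of which only the values at indices
  below \<open>n\<close> matter. The parameter \<open>a^(m+1)\<close> with lower index \<open>T_n^m(p^(k+1))\<close> is the
  variable \<open>(k, m)\<close>, for \<open>k < l\<close> and \<open>m < n\<close>; these are \<open>n * l\<close> distinct variables.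
\<close>

type_synonym 'v monom = "'v \<Rightarrow>\<^sub>0 nat"

text \<open>Polynomials in the parameters with complex coefficients, and polynomials in the coordinates
  whose coefficients are polynomials in the parameters.\<close>

type_synonym apoly = "(nat \<times> nat) monom \<Rightarrow>\<^sub>0 complex"
type_synonym ypoly = "nat monom \<Rightarrow>\<^sub>0 apoly"

definition avar :: "nat \<Rightarrow> nat \<Rightarrow> apoly" where
  "avar k m = Poly_Mapping.single (Poly_Mapping.single (k, m) 1) 1"

definition aconst :: "complex \<Rightarrow> apoly" where
  "aconst c = Poly_Mapping.single 0 c"

definition yvar :: "nat \<Rightarrow> ypoly" where
  "yvar j = Poly_Mapping.single (Poly_Mapping.single j 1) 1"

definition yconst :: "apoly \<Rightarrow> ypoly" where
  "yconst c = Poly_Mapping.single 0 c"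

definition cyc_shift :: "nat \<Rightarrow> (nat \<Rightarrow> int) \<Rightarrow> nat \<Rightarrow> int" where
  "cyc_shift n p = (\<lambda>i. if i = 0 then p (n - 1) else p (i - 1))"


section \<open>The sets \<open>R_m\<close>\<close>

definition is_anu :: "nat \<Rightarrow> nat \<Rightarrow> (nat \<times> nat) monom \<Rightarrow> bool" where
  "is_anu n l \<nu> \<longleftrightarrow> Poly_Mapping.keys \<nu> \<subseteq> {..<l} \<times> {..<n}"

definition L :: "nat \<Rightarrow> nat \<Rightarrow> (nat \<Rightarrow> nat \<Rightarrow> int) \<Rightarrow> (nat \<times> nat) monom \<Rightarrow> nat \<Rightarrow> int" where
  "L n l p \<nu> = (\<lambda>i. \<Sum>k<l. \<Sum>m<n. int (Poly_Mapping.lookup \<nu> (k, m)) * (cyc_shift n ^^ m) (p k) i)"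

text \<open>The \<open>m\<close>-polynomials with coefficients in a set \<open>F\<close> of complex numbers. For \<open>F = \<rat>\<close> this is the
  subset \<open>R_m\<close> of \<open>\<rat>[a]\<close>; for \<open>F = \<rat>(\<zeta>)\<close> it is the subset of \<open>\<rat>(\<zeta>)[a]\<close> given by the same condition,
  which is the \<open>\<rat>(\<zeta>)\<close>-span of \<open>R_m\<close>. Coefficients of normal forms lie in \<open>\<rat>(\<zeta>)[a]\<close> but in
  general not in \<open>\<rat>[a]\<close>, because the homological equation divides by \<open>(\<Sum>j<n. \<alpha>_j * \<zeta> ^ j) - \<zeta> ^ i\<close>:
  for \<open>n = 3\<close>, \<open>p^(1) = (1,0,0)\<close>, \<open>p^(2) = (0,1,1)\<close>, every normal form has
  \<open>y_0 * y_1^2 * y_2\<close> in component \<open>1\<close> with coefficient \<open>- avar 0 1 * avar 1 1 / \<zeta>\<close>.\<close>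

definition R :: "complex set \<Rightarrow> nat \<Rightarrow> nat \<Rightarrow> (nat \<Rightarrow> nat \<Rightarrow> int) \<Rightarrow> (nat \<Rightarrow> int) \<Rightarrow> apoly set" where
  "R F n l p m = {f. \<forall>\<nu> \<in> Poly_Mapping.keys f.
      Poly_Mapping.lookup f \<nu> \<in> F \<and> is_anu n l \<nu> \<and> (\<forall>i<n. L n l p \<nu> i = m i)}"

definition is_subfield :: "complex set \<Rightarrow> bool" where
  "is_subfield F \<longleftrightarrow> 1 \<in> F \<and> (\<forall>x\<in>F. \<forall>y\<in>F. x - y \<in> F \<and> x * y \<in> F \<and> inverse x \<in> F)"

definition rat_adjoin :: "complex \<Rightarrow> complex set" where
  "rat_adjoin z = \<Inter> {F. is_subfield F \<and> z \<in> F}"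


section \<open>Formal power series in the coordinates\<close>

definition is_yhom :: "nat \<Rightarrow> nat \<Rightarrow> nat \<Rightarrow> ypoly \<Rightarrow> bool" where
  "is_yhom n l d f \<longleftrightarrow> (\<forall>\<alpha> \<in> Poly_Mapping.keys f.
      Poly_Mapping.keys \<alpha> \<subseteq> {..<n} \<and> (\<Sum>j<n. Poly_Mapping.lookup \<alpha> j) = d \<and>
      (\<forall>\<nu> \<in> Poly_Mapping.keys (Poly_Mapping.lookup f \<alpha>). is_anu n l \<nu>))"

text \<open>A formal power series \<open>\<Sum>d. U d\<close> in the coordinates, with \<open>U d\<close> homogeneous of degree \<open>d\<close>, is
  encoded as the univariate series over \<open>ypoly\<close> whose \<open>d\<close>-th coefficient is \<open>U d\<close>. Sums and
  products of series then agree with those of \<open>fps\<close>. The following is the series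
  \<open>c * y_i + (\<Sum>d\<ge>2. U d i)\<close>.\<close>

definition yseries :: "complex \<Rightarrow> (nat \<Rightarrow> nat \<Rightarrow> ypoly) \<Rightarrow> nat \<Rightarrow> ypoly fps" where
  "yseries c U i = Abs_fps (\<lambda>d. if d = 1 then yconst (aconst c) * yvar i else if 2 \<le> d then U d i else 0)"

definition ypderiv :: "nat \<Rightarrow> ypoly \<Rightarrow> ypoly" where
  "ypderiv j f = (\<Sum>\<alpha> \<in> Poly_Mapping.keys f.
      Poly_Mapping.single (\<alpha> - Poly_Mapping.single j 1)
        (of_nat (Poly_Mapping.lookup \<alpha> j) * Poly_Mapping.lookup f \<alpha>))"

text \<open>Differentiation with respect to \<open>y_j\<close> lowers the degree by one, whence the index shift.\<close>

definition fps_ypderiv :: "nat \<Rightarrow> ypoly fps \<Rightarrow> ypoly fps" where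
  "fps_ypderiv j f = Abs_fps (\<lambda>d. ypderiv j (fps_nth f (Suc d)))"


section \<open>The system and its normal forms\<close>

text \<open>The right-hand side of the equation for \<open>x_i\<close>. The monomial \<open>x_i * x^(T_n^i(p^(k)))\<close> is written
  with its exponents collected, since the exponent of \<open>x_i\<close> in the second factor may be \<open>-1\<close>.\<close>

definition sys_rhs ::
  "nat \<Rightarrow> nat \<Rightarrow> complex \<Rightarrow> (nat \<Rightarrow> nat \<Rightarrow> int) \<Rightarrow> (nat \<Rightarrow> ypoly fps) \<Rightarrow> nat \<Rightarrow> ypoly fps" where
  "sys_rhs n l \<zeta> p x i =
     fps_const (yconst (aconst (\<zeta> ^ i))) * x i +
     (\<Sum>k<l. fps_const (yconst (avar k i)) *
        (\<Prod>j<n. x j ^ nat ((cyc_shift n ^^ i) (p k) j + (if j = i then 1 else 0))))"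

text \<open>The substitution \<open>x = y + (\<Sum>d\<ge>2. H d)\<close> transforms the system into
  \<open>y' = Z y + (\<Sum>d\<ge>2. G d)\<close>: by the chain rule, \<open>x'\<close> is the Jacobian of \<open>x\<close> applied to \<open>y'\<close>.\<close>

definition transforms_to ::
  "nat \<Rightarrow> nat \<Rightarrow> complex \<Rightarrow> (nat \<Rightarrow> nat \<Rightarrow> int) \<Rightarrow> (nat \<Rightarrow> nat \<Rightarrow> ypoly) \<Rightarrow> (nat \<Rightarrow> nat \<Rightarrow> ypoly) \<Rightarrow> bool"
where
  "transforms_to n l \<zeta> p H G \<longleftrightarrow>
     (\<forall>i<n. (\<Sum>j<n. fps_ypderiv j (yseries 1 H i) * yseries (\<zeta> ^ j) G j) =
            sys_rhs n l \<zeta> p (yseries 1 H) i)"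

definition is_PD_normal_form ::
  "nat \<Rightarrow> nat \<Rightarrow> complex \<Rightarrow> (nat \<Rightarrow> nat \<Rightarrow> int) \<Rightarrow> (nat \<Rightarrow> nat \<Rightarrow> ypoly) \<Rightarrow> bool" where
  "is_PD_normal_form n l \<zeta> p G \<longleftrightarrow>
     (\<forall>d\<ge>2. \<forall>i<n. is_yhom n l d (G d i)) \<and>
     (\<exists>H. (\<forall>d\<ge>2. \<forall>i<n. is_yhom n l d (H d i)) \<and> transforms_to n l \<zeta> p H G) \<and>
     (\<forall>d\<ge>2. \<forall>i<n. \<forall>\<alpha> \<in> Poly_Mapping.keys (G d i).
        (\<Sum>j<n. of_nat (Poly_Mapping.lookup \<alpha> j) * \<zeta> ^ j) - \<zeta> ^ i = 0)"

end

theory Submission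
  imports Defs
begin

text \<open>
  The parameter monomials carry a grading for which the system is homogeneous. Give \<open>[\<nu>] y^\<alpha>\<close> the
  weight \<open>\<alpha> - L(\<nu>)\<close>. Then \<open>y_i\<close> has weight \<open>e_i\<close>, the \<open>i\<close>-th unit vector, and so has every term of
  the \<open>i\<close>-th equation of the system, because the parameter in front of \<open>x_i * x^(T^i p)\<close> has
  \<open>L = T^i p\<close>. Weights add under multiplication, and \<open>d/dy_j\<close> lowers the weight by \<open>e_j\<close>, so all
  terms in the chain rule for a substitution whose \<open>i\<close>-th component has weight \<open>e_i\<close> are again of
  weight \<open>e_i\<close> (\<open>graded_series_defect\<close>).

  The normal form is built degree by degree. Changing the terms \<open>H_d\<close> and \<open>G_d\<close> of degree \<open>d\<close>
  changes the degree-\<open>d\<close> part of the transformation equation only by the linear expression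
  \<open>D H_d - \<zeta>^i H_d + G_d\<close>, where \<open>D\<close> is the derivative along the linear vector field
  (\<open>defect_truncate\<close>). Every monomial \<open>y^\<alpha>\<close> is an eigenvector of \<open>D\<close>, so this
  homological equation is solved term by term: a resonant term goes into \<open>G_d\<close>, any other term is
  divided by its nonzero eigenvalue difference and goes into \<open>H_d\<close>
  (\<open>homological_equation\<close>). Neither operation changes monomials, so the weight is kept, and the
  coefficients stay in \<open>\<rat>(\<zeta>)\<close>.

  It remains to identify the resonant monomials. As \<open>n\<close> is prime, the cyclotomic polynomial
  \<open>1 + x + ... + x^(n-1)\<close> is irreducible, so an integral relation between the powers of \<open>\<zeta>\<close> has
  constant coefficients (\<open>root_of_unity_relation_const\<close>). Hence \<open>\<alpha>\<close> is resonant in component \<open>i\<close>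
  exactly when \<open>\<alpha> = (K, ..., K) + e_i\<close>. The degree \<open>d = n K + 1\<close> determines \<open>K\<close>, so \<open>G_d\<close> has
  a single monomial in each component, and weight \<open>e_i\<close> says that its coefficient consists of
  parameter monomials with \<open>L(\<nu>) = (K, ..., K)\<close>.
\<close>

section \<open>Integral relations between the powers of a primitive root of unity\<close>

text \<open>The inductive core of Eisenstein's criterion: modulo \<open>q\<close> the constant
  coefficient of \<open>h\<close> is invertible, so the lowest coefficient of \<open>g\<close> that is nonzero modulo \<open>q\<close>
  survives in the product \<open>g * h\<close> at the same index.\<close>

lemma prime_dvd_low_coeffs:
  fixes g h :: "int poly" and q :: int
  assumes q: "prime q" and h0: "\<not> q dvd coeff h 0"
    and low: "\<And>i. i < m \<Longrightarrow> q dvd coeff (g * h) i" and i: "i < m"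
  shows "q dvd coeff g i"
  using i
proof (induction i rule: less_induct)
  case (less i)
  have split: "coeff (g * h) i = (\<Sum>j<i. coeff g j * coeff h (i - j)) + coeff g i * coeff h 0"
    by (simp add: coeff_mult lessThan_Suc_atMost [symmetric])
  have "q dvd (\<Sum>j<i. coeff g j * coeff h (i - j))"
    using less by (intro dvd_sum) auto
  moreover have "q dvd coeff (g * h) i" using low less.prems by blast
  ultimately have "q dvd coeff g i * coeff h 0"
    by (simp add: split dvd_add_right_iff)
  then show ?case using q h0 by (simp add: prime_dvd_mult_iff)
qed

lemma degree_ge_if_coprime_cofactor:
  fixes g h :: "int poly" and q :: int
  assumes q: "prime q" and h0: "\<not> q dvd coeff h 0"
    and low: "\<And>i. i < m \<Longrightarrow> q dvd coeff (g * h) i" and top: "\<not> q dvd coeff (g * h) m"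
  shows "m \<le> degree g"
proof (rule ccontr)
  assume "\<not> m \<le> degree g"
  then have gm: "coeff g m = 0" by (simp add: coeff_eq_0)
  have "q dvd coeff g j" if "j \<le> m" for j
    using prime_dvd_low_coeffs [OF q h0 low] that gm by (cases "j = m") auto
  then have "q dvd coeff (g * h) m"
    by (auto simp: coeff_mult intro!: dvd_sum)
  with top show False by blast
qed

lemma eisenstein_factor_degree:
  fixes g h :: "int poly" and q :: int
  assumes q: "prime q" and low: "\<And>i. i < m \<Longrightarrow> q dvd coeff (g * h) i"
    and top: "\<not> q dvd coeff (g * h) m" and bottom: "\<not> q\<^sup>2 dvd coeff (g * h) 0"
  shows "m \<le> degree g \<or> m \<le> degree h"
proof -
  have "\<not> q dvd coeff g 0 \<or> \<not> q dvd coeff h 0"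
    using bottom by (auto simp: coeff_mult_0 power2_eq_square intro: mult_dvd_mono)
  then show ?thesis
    using degree_ge_if_coprime_cofactor [OF q _ low top]
      degree_ge_if_coprime_cofactor [of q g m h] q low top
    by (auto simp: mult.commute)
qed

text \<open>Evaluation of an integer polynomial at a complex number. All relations are handled over the
  integers, where content and pseudo-division replace division over the rationals.\<close>

definition ieval :: "complex \<Rightarrow> int poly \<Rightarrow> complex" where
  "ieval z B = poly (map_poly of_int B) z"

lemma ieval_0 [simp]: "ieval z 0 = 0"
  by (simp add: ieval_def)

lemma ieval_pCons [simp]: "ieval z (pCons a B) = of_int a + z * ieval z B"
  by (simp add: ieval_def map_poly_pCons)

lemma ieval_add [simp]: "ieval z (A + B) = ieval z A + ieval z B"
  by (induction A B rule: poly_induct2) (auto simp: algebra_simps)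

lemma ieval_smult [simp]: "ieval z (smult c B) = of_int c * ieval z B"
  by (induction B) (auto simp: algebra_simps)

lemma ieval_mult [simp]: "ieval z (A * B) = ieval z A * ieval z B"
  by (induction A) (auto simp: algebra_simps)

lemma ieval_sum: "ieval z (sum f S) = (\<Sum>s\<in>S. ieval z (f s))"
  by (induction S rule: infinite_finite_induct) auto

lemma ieval_monom [simp]: "ieval z (monom c k) = of_int c * z ^ k"
  by (simp add: ieval_def map_poly_monom poly_monom)

lemma ieval_pcompose_shift: "ieval z (pcompose B [:1, 1:]) = ieval (1 + z) B"
  by (induction B) (auto simp: pcompose_pCons algebra_simps)

text \<open>A root \<open>z\<close> of an Eisenstein polynomial \<open>E\<close> of degree \<open>m\<close> is not a root of a nonzero polynomial of
  smaller degree: a primitive polynomial \<open>g\<close> of least degree with root \<open>z\<close> divides a constant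
  multiple of \<open>E\<close> by pseudo-division, hence divides \<open>E\<close> by Gauss's lemma on contents, and
  the factors of \<open>E\<close> have degree \<open>0\<close> or at least \<open>m\<close>.\<close>

lemma eisenstein_no_low_degree_relation:
  fixes E B :: "int poly" and q :: int
  assumes q: "prime q" and low: "\<And>i. i < m \<Longrightarrow> q dvd coeff E i"
    and top: "\<not> q dvd coeff E m" and bottom: "\<not> q\<^sup>2 dvd coeff E 0"
    and E: "ieval z E = 0" and m: "degree E \<le> m"
    and B: "ieval z B = 0" "degree B < m"
  shows "B = 0"
proof (rule ccontr)
  assume "B \<noteq> 0"
  then have "\<exists>g. (g \<noteq> 0 \<and> ieval z g = 0) \<and> (\<forall>h. h \<noteq> 0 \<and> ieval z h = 0 \<longrightarrow> degree g \<le> degree h)"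
    using B by (intro ex_has_least_nat [where m = degree]) auto
  then obtain g0 where g0: "g0 \<noteq> 0" "ieval z g0 = 0"
    and least0: "\<And>h. h \<noteq> 0 \<Longrightarrow> ieval z h = 0 \<Longrightarrow> degree g0 \<le> degree h" by blast
  \<comment> \<open>Only a primitive \<open>g\<close> lets the factor \<open>c\<close> of pseudo-division be cancelled below.\<close>
  define g where "g = primitive_part g0"
  have g0_eq: "g0 = smult (content g0) g" by (simp add: g_def)
  have g: "g \<noteq> 0" "content g = 1" and gz: "ieval z g = 0"
    and least: "\<And>h. h \<noteq> 0 \<Longrightarrow> ieval z h = 0 \<Longrightarrow> degree g \<le> degree h"
  proof -
    show "g \<noteq> 0" "content g = 1" using g0 by (auto simp: g_def)
    have "of_int (content g0) * ieval z g = 0" using g0 g0_eq by (metis ieval_smult)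
    then show "ieval z g = 0" using g0 by simp
    have "degree g = degree g0" using g0 by (simp add: g_def)
    then show "degree g \<le> degree h" if "h \<noteq> 0" "ieval z h = 0" for h using least0 that by simp
  qed
  obtain h r where hr: "pseudo_divmod E g = (h, r)" by fastforce
  define c where "c = coeff g (degree g) ^ (Suc (degree E) - degree g)"
  have c: "c \<noteq> 0" using g by (simp add: c_def)
  have div: "smult c E = g * h + r" and r: "r = 0 \<or> degree r < degree g"
    using pseudo_divmod [OF g(1) hr] by (auto simp: c_def)
  have "of_int c * ieval z E = ieval z g * ieval z h + ieval z r"
    using arg_cong [OF div, of "ieval z"] by simp
  then have "ieval z r = 0" using E gz by simp
  then have "r = 0" using r least by (meson leD)
  with div have cE: "smult c E = g * h" by simp
  \<comment> \<open>Gauss's lemma: \<open>g\<close> is primitive, so the content of \<open>c * E\<close> comes from \<open>h\<close> alone.\<close>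
  have "c dvd content h"
  proof -
    have "content (smult c E) = content h" using cE g by (simp add: content_mult)
    then have "normalize c * content E = content h" by simp
    then show ?thesis by (metis dvd_triv_left normalize_dvd_iff)
  qed
  then have "[:c:] dvd h" by (simp add: const_poly_dvd_iff_dvd_content)
  then obtain h' where "h = smult c h'" by (auto simp: dvd_def)
  with cE c have fac: "E = g * h'" by (metis mult_smult_right smult_cancel)
  have "h' \<noteq> 0" using fac top by auto
  have "m \<le> degree g \<or> m \<le> degree h'"
    using eisenstein_factor_degree [OF q, of m g h'] low top bottom fac by auto
  moreover have "degree g \<le> degree B" using least \<open>B \<noteq> 0\<close> B by blast
  moreover have "degree E = degree g + degree h'"
    using fac g \<open>h' \<noteq> 0\<close> by (simp add: degree_mult_eq)
  \<comment> \<open>The degree of \<open>g\<close> is less than \<open>m\<close>, so the cofactor takes up the whole degree of \<open>E\<close>.\<close>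
  ultimately have "degree g = 0" using m B by linarith
  then obtain a where "g = [:a:]" by (metis degree_eq_zeroE)
  with g gz show False by auto
qed

text \<open>Subtracting the relation \<open>1 + \<zeta> + ... + \<zeta>^(n-1) = 0\<close> makes the top coefficient vanish and leaves
  a relation of degree at most \<open>n - 2\<close>. This must be trivial, because
  \<open>z = \<zeta> - 1\<close> is a root of \<open>((z + 1)^n - 1) / z\<close>, which is Eisenstein at \<open>n\<close>.\<close>

lemma root_of_unity_relation_const:
  fixes b :: "nat \<Rightarrow> int" and \<zeta> :: complex
  assumes n: "prime n" and \<zeta>: "\<zeta> ^ n = 1" "\<zeta> \<noteq> 1"
    and rel: "(\<Sum>j<n. of_int (b j) * \<zeta> ^ j) = 0" and j: "j < n"
  shows "b j = b (n - 1)"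
proof -
  have n2: "n \<ge> 2" using n by (simp add: prime_ge_2_nat)
  define z where "z = \<zeta> - 1"
  have z: "z \<noteq> 0" using \<zeta> by (simp add: z_def)
  define E :: "int poly" where "E = (\<Sum>k<n. monom (int (n choose Suc k)) k)"
  have cE: "coeff E i = (if i < n then int (n choose Suc i) else 0)" for i
    by (simp add: E_def coeff_sum)
  have "z * ieval z E = (\<Sum>k<n. of_nat (n choose Suc k) * z ^ Suc k)"
    by (simp add: E_def ieval_sum sum_distrib_left algebra_simps)
  also have "\<dots> = (\<Sum>k\<in>{..<Suc n}. of_nat (n choose k) * z ^ k) - 1"
    by (subst sum.lessThan_Suc_shift) simp
  also have "\<dots> = (z + 1) ^ n - 1"
    by (simp add: binomial_ring lessThan_Suc_atMost)
  also have "\<dots> = 0" using \<zeta> by (simp add: z_def)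
  finally have Ez: "ieval z E = 0" using z by simp
  define B :: "int poly" where "B = (\<Sum>k<n - 1. monom (b k - b (n - 1)) k)"
  have cB: "coeff B i = (if i < n - 1 then b i - b (n - 1) else 0)" for i
    by (simp add: B_def coeff_sum)
  have unity: "(\<Sum>k<n. \<zeta> ^ k) = 0" using \<zeta> by (simp add: geometric_sum)
  have "ieval \<zeta> B = (\<Sum>k<Suc (n - 1). of_int (b k - b (n - 1)) * \<zeta> ^ k)"
    by (simp add: B_def ieval_sum)
  also have "\<dots> = (\<Sum>k<n. of_int (b k) * \<zeta> ^ k) - of_int (b (n - 1)) * (\<Sum>k<n. \<zeta> ^ k)"
    using n2 by (simp add: sum_subtractf sum_distrib_left sum_distrib_right algebra_simps)
  finally have "ieval \<zeta> B = 0" using rel unity by simp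
  then have Bz: "ieval z (pcompose B [:1, 1:]) = 0"
    by (simp add: ieval_pcompose_shift z_def)
  have "degree B \<le> n - 2"
    by (rule degree_le) (auto simp: cB)
  then have degB: "degree (pcompose B [:1, 1:]) < n - 1"
    using n2 by (simp add: degree_pcompose)
  have "pcompose B [:1, 1:] = 0"
  proof (rule eisenstein_no_low_degree_relation [where q = "int n" and E = E and m = "n - 1"])
    show "prime (int n)" using n by simp
    show "int n dvd coeff E i" if "i < n - 1" for i
      using that n by (auto simp: cE intro!: dvd_choose_prime)
    show "\<not> int n dvd coeff E (n - 1)" using n2 by (simp add: cE)
    show "\<not> (int n)\<^sup>2 dvd coeff E 0"
      using n2 by (auto simp: cE power2_eq_square zdvd_not_zless)
    show "degree E \<le> n - 1" by (rule degree_le) (auto simp: cE)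
  qed (use Ez Bz degB n2 in auto)
  then have "B = 0" by (rule pcompose_eq_0) simp
  then have "coeff B j = 0" by simp
  moreover have "j < n - 1 \<or> j = n - 1" using j by linarith
  ultimately show ?thesis by (auto simp: cB)
qed

section \<open>Subfields of the complex numbers\<close>

lemma subfield_arith:
  assumes F: "is_subfield F"
  shows subfield_0: "0 \<in> F" and subfield_1: "1 \<in> F"
    and subfield_diff: "\<And>x y. x \<in> F \<Longrightarrow> y \<in> F \<Longrightarrow> x - y \<in> F"
    and subfield_add: "\<And>x y. x \<in> F \<Longrightarrow> y \<in> F \<Longrightarrow> x + y \<in> F"
    and subfield_mult: "\<And>x y. x \<in> F \<Longrightarrow> y \<in> F \<Longrightarrow> x * y \<in> F"
    and subfield_divide: "\<And>x y. x \<in> F \<Longrightarrow> y \<in> F \<Longrightarrow> x / y \<in> F"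
proof -
  show one: "1 \<in> F" and diff: "\<And>x y. x \<in> F \<Longrightarrow> y \<in> F \<Longrightarrow> x - y \<in> F"
    and mult: "\<And>x y. x \<in> F \<Longrightarrow> y \<in> F \<Longrightarrow> x * y \<in> F"
    using F by (auto simp: is_subfield_def)
  show zero: "0 \<in> F" using diff [OF one one] by simp
  have uminus: "- x \<in> F" if "x \<in> F" for x using diff [OF zero that] by simp
  show "x + y \<in> F" if "x \<in> F" "y \<in> F" for x y
    using diff [OF that(1) uminus [OF that(2)]] by simp
  show "x / y \<in> F" if "x \<in> F" "y \<in> F" for x y
    using mult [OF that(1), of "inverse y"] F that by (auto simp: is_subfield_def divide_inverse)
qed

lemma subfield_sum:
  assumes "is_subfield F" "\<And>s. s \<in> S \<Longrightarrow> f s \<in> F"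
  shows "sum f S \<in> F"
  using assms(2) by (induction S rule: infinite_finite_induct) (auto intro: subfield_arith [OF assms(1)])

lemma subfield_power: "is_subfield F \<Longrightarrow> x \<in> F \<Longrightarrow> x ^ k \<in> F"
  by (induction k) (auto intro: subfield_arith)

lemma subfield_of_nat: "is_subfield F \<Longrightarrow> of_nat k \<in> F"
  by (induction k) (auto intro: subfield_arith)

lemma is_subfield_rat_adjoin: "is_subfield (rat_adjoin z)"
  unfolding rat_adjoin_def is_subfield_def by blast

lemma generator_in_rat_adjoin: "z \<in> rat_adjoin z"
  by (auto simp: rat_adjoin_def)

section \<open>Terms and the linear part of the vector field\<close>

definition yterm :: "nat monom \<Rightarrow> (nat \<times> nat) monom \<Rightarrow> complex \<Rightarrow> ypoly" where
  "yterm \<alpha> \<nu> c = Poly_Mapping.single \<alpha> (Poly_Mapping.single \<nu> c)"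

lemma yterm_0 [simp]: "yterm \<alpha> \<nu> 0 = 0"
  by (simp add: yterm_def)

lemma yterm_add: "yterm \<alpha> \<nu> (c + d) = yterm \<alpha> \<nu> c + yterm \<alpha> \<nu> d"
  by (simp add: yterm_def single_add)

lemma yterm_diff: "yterm \<alpha> \<nu> (c - d) = yterm \<alpha> \<nu> c - yterm \<alpha> \<nu> d"
  by (simp add: yterm_def single_diff)

lemma yterm_sum: "yterm \<alpha> \<nu> (sum f S) = (\<Sum>s\<in>S. yterm \<alpha> \<nu> (f s))"
  by (induction S rule: infinite_finite_induct) (auto simp: yterm_add)

lemma yterm_mult: "yterm \<alpha> \<nu> c * yterm \<beta> \<mu> d = yterm (\<alpha> + \<beta>) (\<nu> + \<mu>) (c * d)"
  by (simp add: yterm_def mult_single)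

lemma yvar_eq_yterm: "yvar j = yterm (Poly_Mapping.single j 1) 0 1"
  by (simp add: yvar_def yterm_def)

lemma yconst_aconst_eq_yterm: "yconst (aconst c) = yterm 0 0 c"
  by (simp add: yconst_def aconst_def yterm_def)

lemma yconst_avar_eq_yterm: "yconst (avar k m) = yterm 0 (Poly_Mapping.single (k, m) 1) 1"
  by (simp add: yconst_def avar_def yterm_def)

lemma keys_yterm_subset: "Poly_Mapping.keys (yterm \<alpha> \<nu> c) \<subseteq> {\<alpha>}"
  by (simp add: yterm_def)

lemma sum_single_eq: "(\<Sum>\<alpha>\<in>Poly_Mapping.keys f. Poly_Mapping.single \<alpha> (Poly_Mapping.lookup f \<alpha>)) = f"
  by (rule poly_mapping_eqI)
    (auto simp: lookup_sum lookup_single when_def in_keys_iff sum.delta' cong: if_cong)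

text \<open>This underlies the induction principle \<open>graded_induct\<close>, by which additive statements need to be
  checked on terms only.\<close>

lemma sum_yterm_eq:
  "(\<Sum>\<alpha>\<in>Poly_Mapping.keys f. \<Sum>\<nu>\<in>Poly_Mapping.keys (Poly_Mapping.lookup f \<alpha>).
      yterm \<alpha> \<nu> (Poly_Mapping.lookup (Poly_Mapping.lookup f \<alpha>) \<nu>)) = f"
proof -
  have "(\<Sum>\<nu>\<in>Poly_Mapping.keys g. yterm \<alpha> \<nu> (Poly_Mapping.lookup g \<nu>)) = Poly_Mapping.single \<alpha> g" for \<alpha> g
  proof -
    have "(\<Sum>\<nu>\<in>S. yterm \<alpha> \<nu> (h \<nu>)) = Poly_Mapping.single \<alpha> (\<Sum>\<nu>\<in>S. Poly_Mapping.single \<nu> (h \<nu>))" for S h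
      by (induction S rule: infinite_finite_induct) (auto simp: yterm_def single_add)
    then show ?thesis by (simp add: sum_single_eq)
  qed
  then show ?thesis by (simp add: sum_single_eq)
qed

text \<open>Summing over a larger set than the support makes additivity of the derivative visible, since two
  polynomials can share one index set.\<close>

lemma ypderiv_eq_sum:
  assumes "finite A" "Poly_Mapping.keys f \<subseteq> A"
  shows "ypderiv j f = (\<Sum>\<alpha>\<in>A. Poly_Mapping.single (\<alpha> - Poly_Mapping.single j 1)
           (of_nat (Poly_Mapping.lookup \<alpha> j) * Poly_Mapping.lookup f \<alpha>))"
  unfolding ypderiv_def using assms
  by (intro sum.mono_neutral_left) (auto simp: in_keys_iff)

lemma ypderiv_0 [simp]: "ypderiv j 0 = 0"
  by (simp add: ypderiv_def)

lemma ypderiv_add: "ypderiv j (f + g) = ypderiv j f + ypderiv j g"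
proof -
  define A where "A = Poly_Mapping.keys f \<union> Poly_Mapping.keys g"
  have A: "finite A" "Poly_Mapping.keys f \<subseteq> A" "Poly_Mapping.keys g \<subseteq> A"
    "Poly_Mapping.keys (f + g) \<subseteq> A"
    using keys_add [of f g] by (auto simp: A_def)
  show ?thesis
    by (simp add: ypderiv_eq_sum [OF A(1,2)] ypderiv_eq_sum [OF A(1,3)] ypderiv_eq_sum [OF A(1,4)]
        lookup_add distrib_left single_add sum.distrib)
qed

lemma ypderiv_yterm:
  "ypderiv j (yterm \<alpha> \<nu> c) =
     yterm (\<alpha> - Poly_Mapping.single j 1) \<nu> (of_nat (Poly_Mapping.lookup \<alpha> j) * c)"
proof -
  have nat: "of_nat k * Poly_Mapping.single \<nu> c = Poly_Mapping.single \<nu> (of_nat k * c)" for k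
    by (simp flip: single_of_nat add: mult_single)
  have "ypderiv j (yterm \<alpha> \<nu> c) = (\<Sum>\<beta>\<in>{\<alpha>}. Poly_Mapping.single (\<beta> - Poly_Mapping.single j 1)
           (of_nat (Poly_Mapping.lookup \<beta> j) * Poly_Mapping.lookup (yterm \<alpha> \<nu> c) \<beta>))"
    by (rule ypderiv_eq_sum) (use keys_yterm_subset in auto)
  then show ?thesis by (simp add: yterm_def nat)
qed

lemma ypderiv_yvar: "ypderiv j (yvar i) = (if j = i then 1 else 0)"
  by (simp add: yvar_eq_yterm ypderiv_yterm lookup_single when_def)
    (simp add: yterm_def flip: single_one)

lemma ypderiv_yterm_yvar:
  "ypderiv j (yterm \<alpha> \<nu> c) * (yconst (aconst b) * yvar j) =
     yterm \<alpha> \<nu> (of_nat (Poly_Mapping.lookup \<alpha> j) * b * c)"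
proof (cases "Poly_Mapping.lookup \<alpha> j = 0")
  case True
  then show ?thesis by (simp add: ypderiv_yterm)
next
  case False
  \<comment> \<open>The exponent subtraction is truncated, so the exponent of \<open>y_j\<close> must be positive here.\<close>
  have "\<alpha> - Poly_Mapping.single j 1 + Poly_Mapping.single j 1 = \<alpha>"
    using False by (intro poly_mapping_eqI) (auto simp: lookup_add lookup_minus lookup_single when_def)
  then show ?thesis
    by (simp add: ypderiv_yterm yvar_eq_yterm yconst_aconst_eq_yterm yterm_mult algebra_simps)
qed

text \<open>The Lie derivative along the linear vector field \<open>y_j' = \<zeta>^j * y_j\<close>.\<close>

definition linear_deriv :: "nat \<Rightarrow> complex \<Rightarrow> ypoly \<Rightarrow> ypoly" where
  "linear_deriv n \<zeta> f = (\<Sum>j<n. ypderiv j f * (yconst (aconst (\<zeta> ^ j)) * yvar j))"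

definition eigenvalue :: "nat \<Rightarrow> complex \<Rightarrow> nat monom \<Rightarrow> complex" where
  "eigenvalue n \<zeta> \<alpha> = (\<Sum>j<n. of_nat (Poly_Mapping.lookup \<alpha> j) * \<zeta> ^ j)"

lemma linear_deriv_0 [simp]: "linear_deriv n \<zeta> 0 = 0"
  by (simp add: linear_deriv_def)

lemma linear_deriv_add: "linear_deriv n \<zeta> (f + g) = linear_deriv n \<zeta> f + linear_deriv n \<zeta> g"
  by (simp add: linear_deriv_def ypderiv_add distrib_right sum.distrib)

lemma linear_deriv_yterm: "linear_deriv n \<zeta> (yterm \<alpha> \<nu> c) = yterm \<alpha> \<nu> (eigenvalue n \<zeta> \<alpha> * c)"
  by (simp add: linear_deriv_def ypderiv_yterm_yvar eigenvalue_def sum_distrib_right yterm_sum)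

section \<open>The weights of parameter monomials and the exponents of the system\<close>

text \<open>The shift \<open>T^m\<close> moves entry \<open>i - m\<close> to position \<open>i\<close>; the index is written as \<open>i + (n - m)\<close> to avoid
  truncated subtraction.\<close>

lemma cyc_shift_funpow:
  assumes "m < n" "i < n"
  shows "(cyc_shift n ^^ m) q i = q ((i + (n - m)) mod n)"
  using assms
proof (induction m arbitrary: i)
  case 0
  then show ?case by simp
next
  case (Suc m)
  show ?case
  proof (cases "i = 0")
    case True
    have "(n - 1 + (n - m)) mod n = (n - Suc m) mod n"
    proof -
      have "n - 1 + (n - m) = (n - Suc m) + n" using Suc.prems by simp
      then show ?thesis by (metis mod_add_self2)
    qed
    then show ?thesis using True Suc by (simp add: cyc_shift_def)
  next
    case False
    then show ?thesis using Suc by (simp add: cyc_shift_def)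
  qed
qed

lemma sum_cyc_shift:
  assumes "0 < n"
  shows "(\<Sum>i<n. (cyc_shift n ^^ m) q i) = (\<Sum>i<n. q i)"
proof -
  obtain N where N: "n = Suc N" using assms by (cases n) auto
  have "(\<Sum>i<n. cyc_shift n r i) = (\<Sum>i<n. r i)" for r
    unfolding N sum.lessThan_Suc_shift [of "cyc_shift _ _"] by (simp add: cyc_shift_def)
  then show ?thesis by (induction m) auto
qed

text \<open>The only entry of \<open>v\<close> that may be \<open>-1\<close> is the one at index \<open>0\<close>, which \<open>T^i\<close> moves to index \<open>i\<close>,
  where the factor \<open>x_i\<close> in front of the monomial compensates it. So \<open>nat\<close> in the system truncates
  nothing.\<close>

lemma sys_exponent:
  fixes v :: "nat \<Rightarrow> int"
  assumes v: "v 0 \<ge> -1 \<and> (\<forall>i. 1 \<le> i \<and> i < n \<longrightarrow> v i \<ge> 0)" and i: "i < n" and j: "j < n"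
  shows "0 \<le> (cyc_shift n ^^ i) v j + (if j = i then 1 else 0)"
proof (cases "j = i")
  case True
  then show ?thesis using v i by (simp add: cyc_shift_funpow)
next
  case False
  define r where "r = (j + (n - i)) mod n"
  have "r \<noteq> 0"
  proof
    \<comment> \<open>As \<open>0 < j + (n - i) < 2 n\<close>, divisibility by \<open>n\<close> would force \<open>j = i\<close>.\<close>
    assume "r = 0"
    then have "n dvd j + (n - i)" by (auto simp: r_def)
    then obtain c where c: "j + (n - i) = n * c" by (auto simp: dvd_def)
    have "0 < n * c" "n * c < n * 2" using c i j by linarith+
    then have "c = 1" by simp
    then show False using c i False by simp
  qed
  moreover have "r < n" using i by (simp add: r_def)
  ultimately have "v r \<ge> 0" using v by simp
  then show ?thesis using i j False by (simp add: cyc_shift_funpow r_def)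
qed

lemma sys_exponent_sum:
  fixes v :: "nat \<Rightarrow> int"
  assumes v: "v 0 \<ge> -1 \<and> (\<forall>i. 1 \<le> i \<and> i < n \<longrightarrow> v i \<ge> 0)" and i: "i < n"
    and sum: "(\<Sum>j<n. v j) \<ge> 1"
  shows "2 \<le> (\<Sum>j<n. nat ((cyc_shift n ^^ i) v j + (if j = i then 1 else 0)))"
proof -
  have "int (\<Sum>j<n. nat ((cyc_shift n ^^ i) v j + (if j = i then 1 else 0)))
      = (\<Sum>j<n. (cyc_shift n ^^ i) v j + (if j = i then 1 else 0))"
    unfolding of_nat_sum
    by (rule sum.cong) (use sys_exponent [OF v i] in auto)
  also have "\<dots> = (\<Sum>j<n. v j) + 1"
    using i by (simp add: sum.distrib sum_cyc_shift)
  finally show ?thesis using sum by linarith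
qed

lemma L_add: "L n l p (\<nu> + \<mu>) i = L n l p \<nu> i + L n l p \<mu> i"
  by (simp add: L_def lookup_add distrib_right sum.distrib)

lemma L_0: "L n l p 0 i = 0"
  by (simp add: L_def)

lemma L_single:
  assumes "k < l" "m < n"
  shows "L n l p (Poly_Mapping.single (k, m) 1) i = (cyc_shift n ^^ m) (p k) i"
proof -
  have "L n l p (Poly_Mapping.single (k, m) 1) i =
      (\<Sum>k'<l. \<Sum>m'<n. if k' = k \<and> m' = m then (cyc_shift n ^^ m) (p k) i else 0)"
    unfolding L_def by (intro sum.cong) (auto simp: lookup_single when_def)
  also have "\<dots> = (\<Sum>k'<l. if k' = k then (cyc_shift n ^^ m) (p k) i else 0)"
    using assms by (intro sum.cong) auto
  finally show ?thesis using assms by simp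
qed

lemma is_anu_0: "is_anu n l 0"
  by (simp add: is_anu_def)

lemma is_anu_add: "is_anu n l \<nu> \<Longrightarrow> is_anu n l \<mu> \<Longrightarrow> is_anu n l (\<nu> + \<mu>)"
  using keys_add [of \<nu> \<mu>] by (auto simp: is_anu_def)

lemma is_anu_single: "k < l \<Longrightarrow> m < n \<Longrightarrow> is_anu n l (Poly_Mapping.single (k, m) 1)"
  by (simp add: is_anu_def)

section \<open>Polynomials graded by degree and weight\<close>

locale parameter_grading =
  fixes n l :: nat and p :: "nat \<Rightarrow> nat \<Rightarrow> int" and F :: "complex set"
  assumes F: "is_subfield F"
begin

text \<open>The term \<open>[\<nu>] y^\<alpha>\<close> has degree \<open>d\<close> and weight \<open>m = \<alpha> - L(\<nu>)\<close>. The weight is a vector of integers,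
  not of naturals: the parameter \<open>avar k i\<close> alone has weight \<open>- T^i p^(k)\<close>.\<close>

definition admissible :: "nat \<Rightarrow> (nat \<Rightarrow> int) \<Rightarrow> nat monom \<Rightarrow> (nat \<times> nat) monom \<Rightarrow> bool" where
  "admissible d m \<alpha> \<nu> \<longleftrightarrow>
     Poly_Mapping.keys \<alpha> \<subseteq> {..<n} \<and> (\<Sum>j<n. Poly_Mapping.lookup \<alpha> j) = d \<and>
     is_anu n l \<nu> \<and> (\<forall>i<n. L n l p \<nu> i = int (Poly_Mapping.lookup \<alpha> i) - m i)"

definition graded :: "nat \<Rightarrow> (nat \<Rightarrow> int) \<Rightarrow> ypoly \<Rightarrow> bool" where
  "graded d m f \<longleftrightarrow> (\<forall>\<alpha>\<in>Poly_Mapping.keys f. \<forall>\<nu>\<in>Poly_Mapping.keys (Poly_Mapping.lookup f \<alpha>).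
     Poly_Mapping.lookup (Poly_Mapping.lookup f \<alpha>) \<nu> \<in> F \<and> admissible d m \<alpha> \<nu>)"

text \<open>The membership in \<open>F\<close> can be asked of all coefficients, as \<open>0\<close> lies in \<open>F\<close>. In this form closure
  properties reduce to coefficientwise ones.\<close>

lemma graded_iff:
  "graded d m f \<longleftrightarrow> (\<forall>\<alpha> \<nu>. Poly_Mapping.lookup (Poly_Mapping.lookup f \<alpha>) \<nu> \<in> F \<and>
     (Poly_Mapping.lookup (Poly_Mapping.lookup f \<alpha>) \<nu> \<noteq> 0 \<longrightarrow> admissible d m \<alpha> \<nu>))"
proof -
  have "Poly_Mapping.lookup f \<alpha> \<noteq> 0" if "Poly_Mapping.lookup (Poly_Mapping.lookup f \<alpha>) \<nu> \<noteq> 0" for \<alpha> \<nu>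
    using that by auto
  then show ?thesis
    unfolding graded_def Ball_def in_keys_iff using subfield_0 [OF F] by metis
qed

lemma graded_0 [simp]: "graded d m 0"
  by (simp add: graded_def)

lemma graded_add: "graded d m f \<Longrightarrow> graded d m g \<Longrightarrow> graded d m (f + g)"
  unfolding graded_iff lookup_add using subfield_add [OF F] by (metis add_0)

lemma graded_diff: "graded d m f \<Longrightarrow> graded d m g \<Longrightarrow> graded d m (f - g)"
  unfolding graded_iff lookup_minus using subfield_diff [OF F] by (metis diff_zero diff_self)

lemma graded_sum: "(\<And>s. s \<in> S \<Longrightarrow> graded d m (f s)) \<Longrightarrow> graded d m (sum f S)"
  by (induction S rule: infinite_finite_induct) (auto intro: graded_add)

lemma graded_cong: "(\<And>i. i < n \<Longrightarrow> m i = m' i) \<Longrightarrow> graded d m f \<longleftrightarrow> graded d m' f"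
  by (simp add: graded_def admissible_def)

lemma graded_yterm: "admissible d m \<alpha> \<nu> \<Longrightarrow> c \<in> F \<Longrightarrow> graded d m (yterm \<alpha> \<nu> c)"
  using subfield_0 [OF F] by (auto simp: graded_iff yterm_def lookup_single when_def)

lemma graded_induct [consumes 1, case_names zero add yterm]:
  assumes f: "graded d m f" and zero: "P 0" and add: "\<And>f g. P f \<Longrightarrow> P g \<Longrightarrow> P (f + g)"
    and yterm: "\<And>\<alpha> \<nu> c. admissible d m \<alpha> \<nu> \<Longrightarrow> c \<in> F \<Longrightarrow> P (yterm \<alpha> \<nu> c)"
  shows "P f"
proof -
  have sum: "P (sum h S)" if "\<And>s. s \<in> S \<Longrightarrow> P (h s)" for h :: "'b \<Rightarrow> ypoly" and S
    using that by (induction S rule: infinite_finite_induct) (auto intro: zero add)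
  have sum': "P (sum h S)" if "\<And>s. s \<in> S \<Longrightarrow> P (h s)" for h :: "'c \<Rightarrow> ypoly" and S
    using that by (induction S rule: infinite_finite_induct) (auto intro: zero add)
  show ?thesis
    using f by (subst sum_yterm_eq [of f, symmetric]) (auto simp: graded_def intro!: sum sum' yterm)
qed

lemma admissible_add:
  assumes "admissible d m \<alpha> \<nu>" "admissible d' m' \<beta> \<mu>"
  shows "admissible (d + d') (\<lambda>i. m i + m' i) (\<alpha> + \<beta>) (\<nu> + \<mu>)"
  using assms keys_add [of \<alpha> \<beta>]
  by (auto simp: admissible_def lookup_add L_add sum.distrib is_anu_add)

lemma graded_mult:
  assumes f: "graded d m f" and g: "graded d' m' g"
  shows "graded (d + d') (\<lambda>i. m i + m' i) (f * g)"
  using f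
proof (induction rule: graded_induct)
  case (yterm \<alpha> \<nu> c)
  show ?case
    using g by (induction rule: graded_induct)
      (auto simp: distrib_left yterm_mult intro!: graded_add graded_yterm admissible_add yterm
        subfield_mult [OF F])
qed (auto simp: distrib_right intro: graded_add)

lemma graded_ypderiv:
  assumes f: "graded (Suc d) m f" and j: "j < n"
  shows "graded d (\<lambda>i. m i - (if i = j then 1 else 0)) (ypderiv j f)"
  using f
proof (induction rule: graded_induct)
  case (yterm \<alpha> \<nu> c)
  show ?case
  proof (cases "Poly_Mapping.lookup \<alpha> j = 0")
    case False
    define \<beta> where "\<beta> = \<alpha> - Poly_Mapping.single j (1::nat)"
    have \<alpha>: "\<alpha> = \<beta> + Poly_Mapping.single j 1"
      using False by (intro poly_mapping_eqI)
        (auto simp: \<beta>_def lookup_add lookup_minus lookup_single when_def)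
    have "Poly_Mapping.keys \<beta> \<subseteq> Poly_Mapping.keys \<alpha>"
      by (auto simp: \<alpha> in_keys_iff lookup_add)
    moreover have "(\<Sum>i<n. Poly_Mapping.lookup \<alpha> i) = Suc (\<Sum>i<n. Poly_Mapping.lookup \<beta> i)"
      using j by (simp add: \<alpha> lookup_add sum.distrib lookup_single when_def)
    moreover have "int (Poly_Mapping.lookup \<alpha> i) = int (Poly_Mapping.lookup \<beta> i) + (if i = j then 1 else 0)" for i
      by (simp add: \<alpha> lookup_add lookup_single when_def)
    ultimately have "admissible d (\<lambda>i. m i - (if i = j then 1 else 0)) \<beta> \<nu>"
      using yterm by (auto simp: admissible_def)
    then show ?thesis
      using yterm subfield_of_nat [OF F]
      by (auto simp: ypderiv_yterm \<beta>_def intro!: graded_yterm subfield_mult [OF F])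
  qed (simp add: ypderiv_yterm)
qed (auto simp: ypderiv_add intro: graded_add)

lemma graded_imp_is_yhom:
  assumes "graded d m f"
  shows "is_yhom n l d f"
  unfolding is_yhom_def
proof (intro ballI conjI)
  fix \<alpha> assume \<alpha>: "\<alpha> \<in> Poly_Mapping.keys f"
  then have "Poly_Mapping.keys (Poly_Mapping.lookup f \<alpha>) \<noteq> {}"
    by (metis in_keys_iff ex_in_conv lookup_zero poly_mapping_eqI)
  then obtain \<nu> where "\<nu> \<in> Poly_Mapping.keys (Poly_Mapping.lookup f \<alpha>)" by blast
  then have "admissible d m \<alpha> \<nu>" using assms \<alpha> by (auto simp: graded_def)
  then show "Poly_Mapping.keys \<alpha> \<subseteq> {..<n}" "(\<Sum>j<n. Poly_Mapping.lookup \<alpha> j) = d"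
    by (auto simp: admissible_def)
qed (use assms in \<open>auto simp: graded_def admissible_def\<close>)

text \<open>Term by term: \<open>y^\<alpha>\<close> is an eigenvector of the operator \<open>D - \<zeta>^i\<close> on the left. If the eigenvalue is
  zero, the term is resonant and is put into \<open>g\<close>; otherwise it is divided by the eigenvalue and put
  into \<open>h\<close>. Both preserve degree and weight, and the eigenvalue lies in the field \<open>F\<close>.\<close>

lemma homological_equation:
  assumes \<zeta>: "\<zeta> \<in> F" and w: "graded d m w"
  shows "\<exists>h g. graded d m h \<and> graded d m g \<and>
    (\<forall>\<alpha>\<in>Poly_Mapping.keys g. eigenvalue n \<zeta> \<alpha> = \<zeta> ^ i) \<and>
    linear_deriv n \<zeta> h - yconst (aconst (\<zeta> ^ i)) * h + g = w"
  using w
proof (induction rule: graded_induct)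
  case zero
  show ?case by (intro exI [of _ 0]) simp
next
  case (add v w)
  then obtain h g h' g' where
    hg: "graded d m h" "graded d m g" "\<forall>\<alpha>\<in>Poly_Mapping.keys g. eigenvalue n \<zeta> \<alpha> = \<zeta> ^ i"
      "linear_deriv n \<zeta> h - yconst (aconst (\<zeta> ^ i)) * h + g = v"
    and hg': "graded d m h'" "graded d m g'" "\<forall>\<alpha>\<in>Poly_Mapping.keys g'. eigenvalue n \<zeta> \<alpha> = \<zeta> ^ i"
      "linear_deriv n \<zeta> h' - yconst (aconst (\<zeta> ^ i)) * h' + g' = w"
    by blast
  show ?case
  proof (intro exI conjI)
    show "graded d m (h + h')" "graded d m (g + g')" using hg hg' by (auto intro: graded_add)
    show "\<forall>\<alpha>\<in>Poly_Mapping.keys (g + g'). eigenvalue n \<zeta> \<alpha> = \<zeta> ^ i"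
      using hg hg' keys_add [of g g'] by blast
    show "linear_deriv n \<zeta> (h + h') - yconst (aconst (\<zeta> ^ i)) * (h + h') + (g + g') = v + w"
      using hg(4) hg'(4) by (auto simp: linear_deriv_add distrib_left)
  qed
next
  case (yterm \<alpha> \<nu> c)
  show ?case
  proof (cases "eigenvalue n \<zeta> \<alpha> = \<zeta> ^ i")
    case True
    with yterm show ?thesis
      using keys_yterm_subset [of \<alpha> \<nu> c]
      by (intro exI [of _ 0] exI [of _ "yterm \<alpha> \<nu> c"]) (auto intro: graded_yterm)
  next
    case False
    define e where "e = eigenvalue n \<zeta> \<alpha> - \<zeta> ^ i"
    have "e \<in> F"
      unfolding e_def eigenvalue_def
      by (intro subfield_diff [OF F] subfield_sum [OF F] subfield_mult [OF F] subfield_of_nat [OF F]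
          subfield_power [OF F] \<zeta>)
    then have "graded d m (yterm \<alpha> \<nu> (c / e))"
      using yterm by (intro graded_yterm subfield_divide [OF F]) auto
    moreover have "linear_deriv n \<zeta> (yterm \<alpha> \<nu> (c / e)) - yconst (aconst (\<zeta> ^ i)) * yterm \<alpha> \<nu> (c / e)
        = yterm \<alpha> \<nu> (e * (c / e))"
      by (simp add: linear_deriv_yterm yconst_aconst_eq_yterm yterm_mult e_def left_diff_distrib yterm_diff
          del: times_divide_eq_right)
    moreover have "e \<noteq> 0" using False by (simp add: e_def)
    ultimately show ?thesis
      by (intro exI [of _ "yterm \<alpha> \<nu> (c / e)"] exI [of _ 0]) auto
  qed
qed

end

section \<open>Graded power series\<close>

abbreviation axis :: "nat \<Rightarrow> nat \<Rightarrow> int" where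
  "axis j \<equiv> \<lambda>i. if i = j then 1 else 0"

lemma nth_yseries_0 [simp]: "fps_nth (yseries c U i) 0 = 0"
  and nth_yseries_1 [simp]: "fps_nth (yseries c U i) (Suc 0) = yconst (aconst c) * yvar i"
  and nth_yseries_ge_2 [simp]: "2 \<le> d \<Longrightarrow> fps_nth (yseries c U i) d = U d i"
  by (simp_all add: yseries_def)

lemma yconst_aconst_1 [simp]: "yconst (aconst 1) = 1"
  by (simp add: yconst_def aconst_def)

context parameter_grading
begin

text \<open>The index of a coefficient of a series is its degree in the coordinates, so only the weight is a
  parameter.\<close>

definition graded_series :: "(nat \<Rightarrow> int) \<Rightarrow> ypoly fps \<Rightarrow> bool" where
  "graded_series m x \<longleftrightarrow> (\<forall>d. graded d m (fps_nth x d))"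

lemma graded_series_cong: "(\<And>i. i < n \<Longrightarrow> m i = m' i) \<Longrightarrow> graded_series m x \<longleftrightarrow> graded_series m' x"
  using graded_cong [of m m'] by (simp add: graded_series_def)

lemma graded_series_add: "graded_series m x \<Longrightarrow> graded_series m y \<Longrightarrow> graded_series m (x + y)"
  by (simp add: graded_series_def graded_add)

lemma graded_series_diff: "graded_series m x \<Longrightarrow> graded_series m y \<Longrightarrow> graded_series m (x - y)"
  by (simp add: graded_series_def graded_diff)

lemma graded_series_sum: "(\<And>s. s \<in> S \<Longrightarrow> graded_series m (x s)) \<Longrightarrow> graded_series m (sum x S)"
  by (simp add: graded_series_def fps_sum_nth graded_sum)

lemma graded_series_mult:
  assumes "graded_series m x" "graded_series m' y"
  shows "graded_series (\<lambda>i. m i + m' i) (x * y)"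
  unfolding graded_series_def fps_mult_nth
proof (intro allI graded_sum)
  fix d e :: nat assume "e \<in> {0..d}"
  then have "d = e + (d - e)" by simp
  then show "graded d (\<lambda>i. m i + m' i) (fps_nth x e * fps_nth y (d - e))"
    using assms graded_mult [of e m "fps_nth x e" "d - e" m' "fps_nth y (d - e)"]
    by (simp add: graded_series_def)
qed

lemma graded_series_const: "graded 0 m c \<Longrightarrow> graded_series m (fps_const c)"
  by (simp add: graded_series_def)

lemma graded_series_1: "graded_series (\<lambda>_. 0) 1"
proof -
  have "graded 0 (\<lambda>_. 0) (yconst (aconst 1))"
    unfolding yconst_aconst_eq_yterm
    by (intro graded_yterm) (auto simp: admissible_def is_anu_0 L_0 subfield_1 [OF F])
  then show ?thesis using graded_series_const by fastforce
qed

lemma graded_series_power: "graded_series m x \<Longrightarrow> graded_series (\<lambda>i. int k * m i) (x ^ k)"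
proof (induction k)
  case 0
  then show ?case by (simp add: graded_series_1)
next
  case (Suc k)
  then show ?case
    using graded_series_mult [of m x "\<lambda>i. int k * m i" "x ^ k"] by (simp add: algebra_simps)
qed

lemma graded_series_prod:
  "(\<And>s. s \<in> S \<Longrightarrow> graded_series (m s) (x s)) \<Longrightarrow> graded_series (\<lambda>i. \<Sum>s\<in>S. m s i) (prod x S)"
proof (induction S rule: infinite_finite_induct)
  case (insert s S)
  then show ?case
    using graded_series_mult [of "m s" "x s" "\<lambda>i. \<Sum>s\<in>S. m s i" "prod x S"] by simp
qed (simp_all add: graded_series_1)

lemma graded_series_yseries:
  assumes c: "c \<in> F" and i: "i < n" and U: "\<And>d. 2 \<le> d \<Longrightarrow> graded d (axis i) (U d i)"
  shows "graded_series (axis i) (yseries c U i)"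
  unfolding graded_series_def
proof
  fix d :: nat
  have "graded (Suc 0) (axis i) (yconst (aconst c) * yvar i)"
    unfolding yconst_aconst_eq_yterm yvar_eq_yterm yterm_mult
    by (intro graded_yterm) (use c i in \<open>auto simp: admissible_def is_anu_0 L_0 lookup_single when_def\<close>)
  moreover have "d = 0 \<or> d = 1 \<or> 2 \<le> d" by linarith
  ultimately show "graded d (axis i) (fps_nth (yseries c U i) d)"
    using U by auto
qed

lemma graded_series_ypderiv:
  assumes "graded_series m x" "j < n"
  shows "graded_series (\<lambda>i. m i - axis j i) (fps_ypderiv j x)"
  using assms graded_ypderiv by (simp add: graded_series_def fps_ypderiv_def)

text \<open>In each nonlinear term the weight \<open>- T^i p^(k)\<close> of the parameter cancels the exponent \<open>T^i p^(k)\<close> of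
  the monomial, and what is left is the weight \<open>e_i\<close> of the extra factor \<open>x_i\<close>.\<close>

lemma graded_series_sys_rhs:
  assumes i: "i < n" and \<zeta>: "\<zeta> \<in> F"
    and p_range: "\<And>k. k < l \<Longrightarrow> p k 0 \<ge> -1 \<and> (\<forall>i. 1 \<le> i \<and> i < n \<longrightarrow> p k i \<ge> 0)"
    and x: "\<And>j. j < n \<Longrightarrow> graded_series (axis j) (x j)"
  shows "graded_series (axis i) (sys_rhs n l \<zeta> p x i)"
  unfolding sys_rhs_def
proof (intro graded_series_add graded_series_sum)
  have "graded 0 (\<lambda>_. 0) (yconst (aconst (\<zeta> ^ i)))"
    unfolding yconst_aconst_eq_yterm
    by (intro graded_yterm) (auto simp: admissible_def is_anu_0 L_0 subfield_power [OF F \<zeta>])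
  from graded_series_mult [OF graded_series_const [OF this] x [OF i]]
  show "graded_series (axis i) (fps_const (yconst (aconst (\<zeta> ^ i))) * x i)" by simp
next
  fix k assume "k \<in> {..<l}"
  then have k: "k < l" by simp
  define e where "e j = nat ((cyc_shift n ^^ i) (p k) j + (if j = i then 1 else 0))" for j
  have "graded 0 (\<lambda>t. - (cyc_shift n ^^ i) (p k) t) (yconst (avar k i))"
    unfolding yconst_avar_eq_yterm
    by (intro graded_yterm)
      (simp_all add: admissible_def is_anu_single L_single k i subfield_1 [OF F]
        del: One_nat_def)
  moreover have "graded_series (\<lambda>t. \<Sum>j<n. int (e j) * axis j t) (\<Prod>j<n. x j ^ e j)"
    using x by (intro graded_series_prod graded_series_power) auto
  ultimately have "graded_series (\<lambda>t. - (cyc_shift n ^^ i) (p k) t + (\<Sum>j<n. int (e j) * axis j t))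
      (fps_const (yconst (avar k i)) * (\<Prod>j<n. x j ^ e j))"
    by (intro graded_series_mult graded_series_const)
  also have "?this \<longleftrightarrow> graded_series (axis i) (fps_const (yconst (avar k i)) * (\<Prod>j<n. x j ^ e j))"
  proof (rule graded_series_cong)
    fix t assume t: "t < n"
    have "(\<Sum>j<n. int (e j) * axis j t) = (\<Sum>j<n. if j = t then int (e t) else 0)"
      by (intro sum.cong) auto
    then have "(\<Sum>j<n. int (e j) * axis j t) = int (e t)" using t by simp
    also have "\<dots> = (cyc_shift n ^^ i) (p k) t + axis i t"
      using sys_exponent [OF p_range [OF k] i t] by (simp add: e_def)
    finally show "- (cyc_shift n ^^ i) (p k) t + (\<Sum>j<n. int (e j) * axis j t) = axis i t" by simp
  qed
  finally show "graded_series (axis i) (fps_const (yconst (avar k i)) *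
      (\<Prod>j<n. x j ^ nat ((cyc_shift n ^^ i) (p k) j + (if j = i then 1 else 0))))"
    unfolding e_def .
qed

end

section \<open>The defect of a substitution, degree by degree\<close>

text \<open>Both series vanish to order \<open>s\<close>, and their coefficients are equal at all indices below \<open>d + s - 1\<close>
  (written with \<open>Suc\<close> because \<open>d + s\<close> may be \<open>0\<close>). The order \<open>s\<close> is recorded because it improves the
  precision in products: a factor of order \<open>s\<close> shifts the first index of disagreement of the other
  factor by \<open>s\<close>.\<close>

definition agree :: "nat \<Rightarrow> nat \<Rightarrow> 'a::comm_ring_1 fps \<Rightarrow> 'a fps \<Rightarrow> bool" where
  "agree d s x y \<longleftrightarrow> (\<forall>e<s. fps_nth x e = 0 \<and> fps_nth y e = 0) \<and>
     (\<forall>e. Suc e < d + s \<longrightarrow> fps_nth x e = fps_nth y e)"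

lemma agree_1: "agree d 0 1 1"
  by (simp add: agree_def)

lemma agree_mult:
  assumes x: "agree d s x x'" and y: "agree d t y y'"
  shows "agree d (s + t) (x * y) (x' * y')"
proof -
  have zero: "fps_nth (u * v) e = 0"
    if "\<forall>i<s. fps_nth u i = 0" "\<forall>i<t. fps_nth v i = 0" "e < s + t" for u v :: "'a fps" and e
    unfolding fps_mult_nth
  proof (intro sum.neutral ballI)
    fix i assume "i \<in> {0..e}"
    then have "i < s \<or> e - i < t" using that(3) by auto
    then show "fps_nth u i * fps_nth v (e - i) = 0" using that(1,2) by auto
  qed
  have "fps_nth (x * y) e = fps_nth (x' * y') e" if e: "Suc e < d + (s + t)" for e
    unfolding fps_mult_nth
  proof (rule sum.cong)
    fix i assume i: "i \<in> {0..e}"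
    consider "i < s" | "e - i < t" | "s \<le> i" "t \<le> e - i" by linarith
    then show "fps_nth x i * fps_nth y (e - i) = fps_nth x' i * fps_nth y' (e - i)"
    proof cases
      case 3
      then have "Suc i < d + s" "Suc (e - i) < d + t" using e i by auto
      then show ?thesis using x y by (simp add: agree_def)
    qed (use x y in \<open>auto simp: agree_def\<close>)
  qed simp
  then show ?thesis using zero x y by (simp add: agree_def)
qed

lemma agree_power: "agree d s x y \<Longrightarrow> agree d (k * s) (x ^ k) (y ^ k)"
  by (induction k) (auto simp: agree_1 intro: agree_mult)

lemma agree_prod:
  "(\<And>j. j \<in> S \<Longrightarrow> agree d (s j) (x j) (y j)) \<Longrightarrow> agree d (sum s S) (prod x S) (prod y S)"
  by (induction S rule: infinite_finite_induct) (auto simp: agree_1 intro: agree_mult)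

definition sys_nonlinear ::
  "nat \<Rightarrow> nat \<Rightarrow> (nat \<Rightarrow> nat \<Rightarrow> int) \<Rightarrow> (nat \<Rightarrow> ypoly fps) \<Rightarrow> nat \<Rightarrow> ypoly fps" where
  "sys_nonlinear n l p x i = (\<Sum>k<l. fps_const (yconst (avar k i)) *
        (\<Prod>j<n. x j ^ nat ((cyc_shift n ^^ i) (p k) j + (if j = i then 1 else 0))))"

lemma sys_rhs_nth:
  "fps_nth (sys_rhs n l \<zeta> p x i) d =
     yconst (aconst (\<zeta> ^ i)) * fps_nth (x i) d + fps_nth (sys_nonlinear n l p x i) d"
  by (simp add: sys_rhs_def sys_nonlinear_def)

text \<open>The nonlinear monomials have total degree at least \<open>2\<close>, so if the arguments agree below degree
  \<open>d\<close>, the values agree below degree \<open>d + 1\<close>. This is why, in degree \<open>d\<close>, the terms of degree \<open>d\<close>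
  of the substitution enter the equation only through its linear part.\<close>

lemma sys_nonlinear_agree:
  assumes i: "i < n"
    and p_range: "\<And>k. k < l \<Longrightarrow> p k 0 \<ge> -1 \<and> (\<forall>i. 1 \<le> i \<and> i < n \<longrightarrow> p k i \<ge> 0)"
    and p_sum: "\<And>k. k < l \<Longrightarrow> (\<Sum>i<n. p k i) \<ge> 1"
    and x: "\<And>j. j < n \<Longrightarrow> agree d 1 (x j) (y j)"
  shows "agree d 2 (sys_nonlinear n l p x i) (sys_nonlinear n l p y i)"
proof -
  have "agree d 2 (\<Prod>j<n. x j ^ nat ((cyc_shift n ^^ i) (p k) j + (if j = i then 1 else 0)))
      (\<Prod>j<n. y j ^ nat ((cyc_shift n ^^ i) (p k) j + (if j = i then 1 else 0)))"
    (is "agree d 2 ?a ?b") if "k < l" for k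
  proof -
    have "agree d (\<Sum>j<n. nat ((cyc_shift n ^^ i) (p k) j + (if j = i then 1 else 0)) * 1) ?a ?b"
      using x by (intro agree_prod agree_power) auto
    then show ?thesis
      using sys_exponent_sum [OF p_range [OF that] i p_sum [OF that]]
      by (auto simp: agree_def)
  qed
  then show ?thesis
    by (auto simp: agree_def sys_nonlinear_def fps_sum_nth intro!: sum.cong sum.neutral)
qed

definition defect ::
  "nat \<Rightarrow> nat \<Rightarrow> complex \<Rightarrow> (nat \<Rightarrow> nat \<Rightarrow> int) \<Rightarrow> (nat \<Rightarrow> nat \<Rightarrow> ypoly) \<Rightarrow> (nat \<Rightarrow> nat \<Rightarrow> ypoly) \<Rightarrow> nat \<Rightarrow> ypoly fps"
where
  "defect n l \<zeta> p H G i = sys_rhs n l \<zeta> p (yseries 1 H) i -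
     (\<Sum>j<n. fps_ypderiv j (yseries 1 H i) * yseries (\<zeta> ^ j) G j)"

lemma transforms_to_iff_defect:
  "transforms_to n l \<zeta> p H G \<longleftrightarrow> (\<forall>i<n. \<forall>d. fps_nth (defect n l \<zeta> p H G i) d = 0)"
  by (auto simp: transforms_to_def defect_def fps_eq_iff)

lemma nth_fps_ypderiv_mult:
  "fps_nth (fps_ypderiv j x * y) d = (\<Sum>e\<le>d. ypderiv j (fps_nth x (Suc e)) * fps_nth y (d - e))"
  by (simp add: fps_mult_nth fps_ypderiv_def atLeast0AtMost)

text \<open>In degree \<open>1\<close> the equation compares the two linear parts, which are both \<open>\<zeta>^i y_i\<close>, and in degree
  \<open>0\<close> both sides vanish.\<close>

lemma defect_below_2:
  assumes i: "i < n" and d: "d < 2"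
    and p_range: "\<And>k. k < l \<Longrightarrow> p k 0 \<ge> -1 \<and> (\<forall>i. 1 \<le> i \<and> i < n \<longrightarrow> p k i \<ge> 0)"
    and p_sum: "\<And>k. k < l \<Longrightarrow> (\<Sum>i<n. p k i) \<ge> 1"
  shows "fps_nth (defect n l \<zeta> p H G i) d = 0"
proof -
  have "agree 1 2 (sys_nonlinear n l p (yseries 1 H) i) (sys_nonlinear n l p (yseries 1 H) i)"
    by (rule sys_nonlinear_agree) (use i p_range p_sum in \<open>auto simp: agree_def\<close>)
  then have N: "fps_nth (sys_nonlinear n l p (yseries 1 H) i) d = 0"
    using d by (simp add: agree_def)
  have "(\<Sum>j<n. ypderiv j (yvar i) * (yconst (aconst (\<zeta> ^ j)) * yvar j))
      = (\<Sum>j<n. if j = i then yconst (aconst (\<zeta> ^ i)) * yvar i else 0)"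
    by (intro sum.cong) (auto simp: ypderiv_yvar)
  then have lin: "(\<Sum>j<n. ypderiv j (yvar i) * (yconst (aconst (\<zeta> ^ j)) * yvar j))
      = yconst (aconst (\<zeta> ^ i)) * yvar i" using i by simp
  have "d = 0 \<or> d = 1" using d by linarith
  then show ?thesis
    using N lin by (auto simp: defect_def sys_rhs_nth fps_sum_nth nth_fps_ypderiv_mult)
qed

text \<open>In the convolution for degree \<open>d\<close>, the terms \<open>G d\<close> and \<open>H d\<close> appear once each: \<open>G d\<close> next to the
  derivative of the leading term \<open>y_i\<close> (\<open>e = 0\<close>), and \<open>H d\<close> next to the linear vector field
  (\<open>e = d - 1\<close>). The factor \<open>H (d + 1)\<close> at \<open>e = d\<close> meets the vanishing constant coefficient of the
  vector field, and all others have index below \<open>d\<close>.\<close>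

lemma chain_rule_truncate:
  assumes d: "2 \<le> d"
    and H: "\<And>e. e < d \<Longrightarrow> H e = H' e" and G: "\<And>e. e < d \<Longrightarrow> G e = G' e"
    and H'd: "H' d = (\<lambda>_. 0)" and G'd: "G' d = (\<lambda>_. 0)"
  shows "fps_nth (fps_ypderiv j (yseries 1 H i) * yseries c G j) d =
    fps_nth (fps_ypderiv j (yseries 1 H' i) * yseries c G' j) d +
    ypderiv j (yvar i) * G d j + ypderiv j (H d i) * (yconst (aconst c) * yvar j)"
proof -
  have "ypderiv j (fps_nth (yseries 1 H i) (Suc e)) * fps_nth (yseries c G j) (d - e) =
      ypderiv j (fps_nth (yseries 1 H' i) (Suc e)) * fps_nth (yseries c G' j) (d - e) +
      (if e = 0 then ypderiv j (yvar i) * G d j else 0) +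
      (if e = d - 1 then ypderiv j (H d i) * (yconst (aconst c) * yvar j) else 0)"
    if "e \<le> d" for e
  proof -
    have "e = 0 \<or> e = d - 1 \<and> e \<noteq> 0 \<or> e = d \<and> e \<noteq> 0 \<or> 1 \<le> e \<and> e < d - 1"
      using that by arith
    then consider "e = 0" | "e = d - 1" "e \<noteq> 0" | "e = d" "e \<noteq> 0" | "1 \<le> e" "e < d - 1"
      by blast
    then show ?thesis
    proof cases
      case 1
      then show ?thesis using d by (simp add: G'd)
    next
      case 2
      then have "Suc e = d" "d - e = Suc 0" using d by auto
      then show ?thesis using d 2 by (simp add: H'd)
    next
      case 3
      then show ?thesis using d by simp
    next
      case 4
      then have "2 \<le> Suc e" "2 \<le> d - e" "Suc e < d" "d - e < d" using d by auto
      then show ?thesis using 4 H G by simp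
    qed
  qed
  then have "(\<Sum>e\<le>d. ypderiv j (fps_nth (yseries 1 H i) (Suc e)) * fps_nth (yseries c G j) (d - e)) =
      (\<Sum>e\<le>d. ypderiv j (fps_nth (yseries 1 H' i) (Suc e)) * fps_nth (yseries c G' j) (d - e) +
      (if e = 0 then ypderiv j (yvar i) * G d j else 0) +
      (if e = d - 1 then ypderiv j (H d i) * (yconst (aconst c) * yvar j) else 0))"
    by (intro sum.cong) auto
  then show ?thesis by (simp add: nth_fps_ypderiv_mult sum.distrib)
qed

text \<open>Here \<open>H'\<close> and \<open>G'\<close> stand for the data constructed before degree \<open>d\<close>. The defect in degree \<open>d\<close> can
  be computed from them up to a linear expression in \<open>H d\<close> and \<open>G d\<close>, which the homological equation
  allows to prescribe.\<close>

lemma defect_truncate: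
  assumes i: "i < n" and d: "2 \<le> d"
    and p_range: "\<And>k. k < l \<Longrightarrow> p k 0 \<ge> -1 \<and> (\<forall>i. 1 \<le> i \<and> i < n \<longrightarrow> p k i \<ge> 0)"
    and p_sum: "\<And>k. k < l \<Longrightarrow> (\<Sum>i<n. p k i) \<ge> 1"
    and H: "\<And>e. e < d \<Longrightarrow> H e = H' e" and G: "\<And>e. e < d \<Longrightarrow> G e = G' e"
    and H'd: "H' d = (\<lambda>_. 0)" and G'd: "G' d = (\<lambda>_. 0)"
  shows "fps_nth (defect n l \<zeta> p H G i) d = fps_nth (defect n l \<zeta> p H' G' i) d -
    (linear_deriv n \<zeta> (H d i) - yconst (aconst (\<zeta> ^ i)) * H d i + G d i)"
proof -
  have "fps_nth (yseries 1 H j) e = fps_nth (yseries 1 H' j) e" if "e < d" for e j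
    using H [OF that] by (simp add: yseries_def)
  then have "agree d 2 (sys_nonlinear n l p (yseries 1 H) i) (sys_nonlinear n l p (yseries 1 H') i)"
    by (intro sys_nonlinear_agree) (use i p_range p_sum in \<open>auto simp: agree_def\<close>)
  then have N: "fps_nth (sys_nonlinear n l p (yseries 1 H) i) d = fps_nth (sys_nonlinear n l p (yseries 1 H') i) d"
    by (simp add: agree_def)
  have "(\<Sum>j<n. ypderiv j (yvar i) * G d j) = (\<Sum>j<n. if j = i then G d i else 0)"
    by (intro sum.cong) (auto simp: ypderiv_yvar)
  then have Gd: "(\<Sum>j<n. ypderiv j (yvar i) * G d j) = G d i" using i by simp
  show ?thesis
    using d by (simp add: defect_def sys_rhs_nth N fps_sum_nth linear_deriv_def
        chain_rule_truncate [where H = H and H' = H' and G = G and G' = G', OF d H G H'd G'd] sum.distrib Gd H'd)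
qed

section \<open>Resonant monomials\<close>

text \<open>A resonance is an integral relation between the powers of \<open>\<zeta>\<close> with coefficients
  \<open>\<alpha> - e_i\<close>, so these coefficients have a common value. It is nonnegative since it equals \<open>\<alpha>_j\<close> at
  any index \<open>j\<close> other than \<open>i\<close>.\<close>

lemma resonant_exponents:
  assumes n: "prime n" and \<zeta>: "\<zeta> ^ n = 1" "\<zeta> \<noteq> 1"
    and res: "eigenvalue n \<zeta> \<alpha> = \<zeta> ^ i" and i: "i < n"
  obtains K where "\<And>j. j < n \<Longrightarrow> Poly_Mapping.lookup \<alpha> j = K + (if j = i then 1 else 0)"
proof -
  have n2: "n \<ge> 2" using n by (simp add: prime_ge_2_nat)
  define b where "b j = int (Poly_Mapping.lookup \<alpha> j) - axis i j" for j
  have "(\<Sum>j<n. of_int (b j) * \<zeta> ^ j) =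
      eigenvalue n \<zeta> \<alpha> - (\<Sum>j<n. if j = i then \<zeta> ^ i else 0)"
    unfolding eigenvalue_def sum_subtractf [symmetric]
    by (intro sum.cong) (auto simp: b_def algebra_simps)
  then have "(\<Sum>j<n. of_int (b j) * \<zeta> ^ j) = 0" using res i by simp
  then have const: "b j = b (n - 1)" if "j < n" for j
    using root_of_unity_relation_const [OF n \<zeta>] that by blast
  obtain j where j: "j < n" "j \<noteq> i" using n2 that [of 0] that [of 1] by fastforce
  then have "b j \<ge> 0" by (simp add: b_def)
  then have c: "b (n - 1) \<ge> 0" using const j by metis
  show ?thesis
  proof (rule that [of "nat (b (n - 1))"])
    fix j assume "j < n"
    then have "int (Poly_Mapping.lookup \<alpha> j) = b (n - 1) + axis i j"
      using const [of j] by (simp add: b_def)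
    then show "Poly_Mapping.lookup \<alpha> j = nat (b (n - 1)) + (if j = i then 1 else 0)"
      using c by (auto split: if_splits)
  qed
qed

definition const_monom :: "nat \<Rightarrow> nat \<Rightarrow> nat monom" where
  "const_monom n K = (\<Sum>j<n. Poly_Mapping.single j K)"

lemma lookup_const_monom: "Poly_Mapping.lookup (const_monom n K) j = (if j < n then K else 0)"
  by (simp add: const_monom_def lookup_sum lookup_single when_def)

lemma prod_yvar_power: "(\<Prod>j<n. yvar j ^ K) = Poly_Mapping.single (const_monom n K) 1"
proof -
  have "yvar j ^ K = Poly_Mapping.single (Poly_Mapping.single j K) 1" for j
    by (induction K) (auto simp: yvar_def mult_single simp flip: single_add)
  then show ?thesis
    unfolding const_monom_def by (induction n) (auto simp: mult_single)
qed

lemma const_monom_product: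
  "(\<Prod>j<n. yvar j ^ K) * (yvar i * yconst q) =
     Poly_Mapping.single (const_monom n K + Poly_Mapping.single i 1) q"
proof -
  have "yvar i * yconst q = Poly_Mapping.single (Poly_Mapping.single i 1) q"
    by (simp add: yvar_def yconst_def mult_single)
  then show ?thesis by (simp add: prod_yvar_power mult_single)
qed

context parameter_grading
begin

text \<open>A resonant monomial of degree \<open>d\<close> satisfies \<open>d = n K + 1\<close>, which determines it. In all other
  degrees \<open>g\<close> is zero, and so is the coefficient \<open>q\<close> read off at the monomial \<open>a\<close>; the value
  \<open>(d - 1) div n\<close> is then arbitrary.\<close>

lemma resonant_graded_form:
  assumes n: "prime n" and \<zeta>: "\<zeta> ^ n = 1" "\<zeta> \<noteq> 1" and i: "i < n"
    and g: "graded d (axis i) g"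
    and res: "\<forall>\<alpha>\<in>Poly_Mapping.keys g. eigenvalue n \<zeta> \<alpha> = \<zeta> ^ i"
  shows "\<exists>q \<in> R F n l p (\<lambda>_. int ((d - 1) div n)).
    g = (\<Prod>j<n. yvar j ^ ((d - 1) div n)) * (yvar i * yconst q)"
proof -
  define a where "a = const_monom n ((d - 1) div n) + Poly_Mapping.single i 1"
  have n0: "n > 0" using i by simp
  have keys: "\<alpha> = a" if \<alpha>: "\<alpha> \<in> Poly_Mapping.keys g" for \<alpha>
  proof -
    have "is_yhom n l d g" using graded_imp_is_yhom [OF g] .
    then have supp: "Poly_Mapping.keys \<alpha> \<subseteq> {..<n}" and deg: "(\<Sum>j<n. Poly_Mapping.lookup \<alpha> j) = d"
      using \<alpha> by (auto simp: is_yhom_def)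
    obtain K where K: "\<And>j. j < n \<Longrightarrow> Poly_Mapping.lookup \<alpha> j = K + (if j = i then 1 else 0)"
      using resonant_exponents [OF n \<zeta> _ i] res \<alpha> by metis
    have "d = n * K + 1"
      using deg i by (simp add: K sum.distrib)
    then have "(d - 1) div n = K" using n0 by simp
    moreover have "Poly_Mapping.lookup \<alpha> j = 0" if "\<not> j < n" for j
      using supp that by (auto simp: in_keys_iff)
    ultimately show ?thesis
      using K i by (intro poly_mapping_eqI)
        (auto simp: a_def lookup_add lookup_const_monom lookup_single when_def)
  qed
  define q where "q = Poly_Mapping.lookup g a"
  have "Poly_Mapping.lookup g \<alpha> = 0" if "\<alpha> \<noteq> a" for \<alpha>
    using keys that by (auto simp: in_keys_iff)
  then have "g = Poly_Mapping.single a q"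
    by (intro poly_mapping_eqI) (auto simp: q_def lookup_single when_def)
  moreover have "q \<in> R F n l p (\<lambda>_. int ((d - 1) div n))"
    unfolding R_def
  proof (intro CollectI ballI)
    fix \<nu> assume \<nu>: "\<nu> \<in> Poly_Mapping.keys q"
    then have "a \<in> Poly_Mapping.keys g" by (auto simp: q_def in_keys_iff)
    then have "Poly_Mapping.lookup q \<nu> \<in> F \<and> admissible d (axis i) a \<nu>"
      using g \<nu> by (simp add: graded_def q_def)
    then show "Poly_Mapping.lookup q \<nu> \<in> F \<and> is_anu n l \<nu> \<and> (\<forall>t<n. L n l p \<nu> t = int ((d - 1) div n))"
      by (auto simp: admissible_def a_def lookup_add lookup_const_monom lookup_single when_def)
  qed
  ultimately show ?thesis
    by (intro bexI [of _ q]) (simp_all add: const_monom_product a_def)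
qed

section \<open>Construction of the normal form\<close>

lemma graded_series_defect:
  assumes i: "i < n" and \<zeta>: "\<zeta> \<in> F"
    and p_range: "\<And>k. k < l \<Longrightarrow> p k 0 \<ge> -1 \<and> (\<forall>i. 1 \<le> i \<and> i < n \<longrightarrow> p k i \<ge> 0)"
    and H: "\<And>d i. i < n \<Longrightarrow> graded d (axis i) (H d i)"
    and G: "\<And>d i. i < n \<Longrightarrow> graded d (axis i) (G d i)"
  shows "graded_series (axis i) (defect n l \<zeta> p H G i)"
  unfolding defect_def
proof (intro graded_series_diff graded_series_sum)
  have H': "graded_series (axis j) (yseries 1 H j)" if "j < n" for j
    using that H by (intro graded_series_yseries subfield_1 [OF F]) auto
  then show "graded_series (axis i) (sys_rhs n l \<zeta> p (yseries 1 H) i)"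
    by (intro graded_series_sys_rhs i \<zeta> p_range)
  fix j assume "j \<in> {..<n}"
  then have j: "j < n" by simp
  have "graded_series (axis j) (yseries (\<zeta> ^ j) G j)"
    using j G by (intro graded_series_yseries subfield_power [OF F \<zeta>]) auto
  from graded_series_mult [OF graded_series_ypderiv [OF H' [OF i] j] this]
  show "graded_series (axis i) (fps_ypderiv j (yseries 1 H i) * yseries (\<zeta> ^ j) G j)"
    by (simp only: diff_add_cancel)
qed

text \<open>Recursion on the degree. A state \<open>r = (h, g)\<close> is chosen for each degree \<open>d\<close> such that it solves the
  homological equation whose right-hand side is the defect of the data of smaller degree. Weight and
  degree of that defect are known because the earlier choices are graded.\<close>

lemma graded_normal_form_exists:
  assumes \<zeta>: "\<zeta> \<in> F"
    and p_range: "\<And>k. k < l \<Longrightarrow> p k 0 \<ge> -1 \<and> (\<forall>i. 1 \<le> i \<and> i < n \<longrightarrow> p k i \<ge> 0)"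
    and p_sum: "\<And>k. k < l \<Longrightarrow> (\<Sum>i<n. p k i) \<ge> 1"
  obtains H G where
    "\<And>d i. i < n \<Longrightarrow> graded d (axis i) (H d i)"
    "\<And>d i. i < n \<Longrightarrow> graded d (axis i) (G d i)"
    "\<And>d i. i < n \<Longrightarrow> \<forall>\<alpha>\<in>Poly_Mapping.keys (G d i). eigenvalue n \<zeta> \<alpha> = \<zeta> ^ i"
    "transforms_to n l \<zeta> p H G"
proof -
  \<comment> \<open>The earlier choices are extended by zero from degree \<open>d\<close> on, so that they are graded in all
    degrees and determined by the values of \<open>f\<close> below \<open>d\<close>.\<close>
  define H0 :: "(nat \<Rightarrow> (nat \<Rightarrow> ypoly) \<times> (nat \<Rightarrow> ypoly)) \<Rightarrow> nat \<Rightarrow> nat \<Rightarrow> nat \<Rightarrow> ypoly"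
    where "H0 f d e = (if e < d then fst (f e) else (\<lambda>_. 0))" for f d e
  define G0 :: "(nat \<Rightarrow> (nat \<Rightarrow> ypoly) \<times> (nat \<Rightarrow> ypoly)) \<Rightarrow> nat \<Rightarrow> nat \<Rightarrow> nat \<Rightarrow> ypoly"
    where "G0 f d e = (if e < d then snd (f e) else (\<lambda>_. 0))" for f d e
  define P where "P f d r \<longleftrightarrow> (\<forall>i<n. graded d (axis i) (fst r i) \<and> graded d (axis i) (snd r i) \<and>
      (\<forall>\<alpha>\<in>Poly_Mapping.keys (snd r i). eigenvalue n \<zeta> \<alpha> = \<zeta> ^ i) \<and>
      linear_deriv n \<zeta> (fst r i) - yconst (aconst (\<zeta> ^ i)) * fst r i + snd r i =
        fps_nth (defect n l \<zeta> p (H0 f d) (G0 f d) i) d)" for f d r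
  have "\<exists>f. \<forall>d. P f d (f d)"
  proof (rule dependent_wellorder_choice)
    fix r and f g :: "nat \<Rightarrow> (nat \<Rightarrow> ypoly) \<times> (nat \<Rightarrow> ypoly)" and d :: nat
    assume "\<And>y. y < d \<Longrightarrow> f y = g y"
    then have "H0 f d = H0 g d" "G0 f d = G0 g d" by (auto simp: H0_def G0_def)
    then show "P f d r = P g d r" by (simp add: P_def)
  next
    fix d :: nat and f
    assume prev: "\<And>y. y < d \<Longrightarrow> P f y (f y)"
    have "graded e (axis i) (H0 f d e i)" "graded e (axis i) (G0 f d e i)" if "i < n" for e i
      using prev [of e] that by (auto simp: H0_def G0_def P_def)
    then have "graded d (axis i) (fps_nth (defect n l \<zeta> p (H0 f d) (G0 f d) i) d)" if "i < n" for i
      using graded_series_defect [OF that \<zeta> p_range] by (simp add: graded_series_def)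
    then have "\<forall>i. \<exists>h g. i < n \<longrightarrow> graded d (axis i) h \<and> graded d (axis i) g \<and>
        (\<forall>\<alpha>\<in>Poly_Mapping.keys g. eigenvalue n \<zeta> \<alpha> = \<zeta> ^ i) \<and>
        linear_deriv n \<zeta> h - yconst (aconst (\<zeta> ^ i)) * h + g =
          fps_nth (defect n l \<zeta> p (H0 f d) (G0 f d) i) d"
      using homological_equation [OF \<zeta>] by blast
    then obtain h g where "\<forall>i. i < n \<longrightarrow> graded d (axis i) (h i) \<and> graded d (axis i) (g i) \<and>
        (\<forall>\<alpha>\<in>Poly_Mapping.keys (g i). eigenvalue n \<zeta> \<alpha> = \<zeta> ^ i) \<and>
        linear_deriv n \<zeta> (h i) - yconst (aconst (\<zeta> ^ i)) * h i + g i =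
          fps_nth (defect n l \<zeta> p (H0 f d) (G0 f d) i) d"
      unfolding choice_iff by blast
    then show "\<exists>r. P f d r"
      by (intro exI [of _ "(h, g)"]) (simp add: P_def)
  qed
  then obtain f where f: "\<And>d. P f d (f d)" by blast
  show ?thesis
  proof (rule that [of "\<lambda>d. fst (f d)" "\<lambda>d. snd (f d)"])
    show "transforms_to n l \<zeta> p (\<lambda>d. fst (f d)) (\<lambda>d. snd (f d))"
      unfolding transforms_to_iff_defect
    proof (intro allI impI)
      fix i d assume i: "i < n"
      show "fps_nth (defect n l \<zeta> p (\<lambda>d. fst (f d)) (\<lambda>d. snd (f d)) i) d = 0"
      proof (cases "d < 2")
        case True
        then show ?thesis by (intro defect_below_2 i p_range p_sum)
      next
        case False
        then show ?thesis
          using f [of d] i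
          by (subst defect_truncate [OF i _ p_range p_sum, where H' = "H0 f d" and G' = "G0 f d"])
            (simp_all add: P_def H0_def G0_def)
      qed
    qed
  qed (use f in \<open>simp_all add: P_def\<close>)
qed

end

theorem theorem4p8:
  fixes n l :: nat and \<zeta> :: complex and p :: "nat \<Rightarrow> nat \<Rightarrow> int"
  assumes n: "prime n" "n > 2"
    and \<zeta>: "\<zeta> ^ n = 1" "\<forall>m. 0 < m \<and> m < n \<longrightarrow> \<zeta> ^ m \<noteq> 1"
    and l: "l \<ge> 1"
    and p_range: "\<forall>k<l. p k 0 \<ge> -1 \<and> (\<forall>i. 1 \<le> i \<and> i < n \<longrightarrow> p k i \<ge> 0)"
    and p_sum: "\<forall>k<l. (\<Sum>i<n. p k i) \<ge> 1"
    and p_distinct: "\<forall>k<l. \<forall>k'<l. k \<noteq> k' \<longrightarrow> (\<exists>i<n. p k i \<noteq> p k' i)"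
  shows "\<exists>G. is_PD_normal_form n l \<zeta> p G \<and>
           (\<forall>d\<ge>2. \<exists>(K::nat) (q :: nat \<Rightarrow> apoly).
              (\<forall>i<n. q i \<in> R (rat_adjoin \<zeta>) n l p (\<lambda>_. int K)) \<and>
              (\<forall>i<n. G d i = (\<Prod>j<n. yvar j ^ K) * (yvar i * yconst (q i))))"
proof -
  interpret parameter_grading n l p "rat_adjoin \<zeta>"
    by unfold_locales (rule is_subfield_rat_adjoin)
  have \<zeta>1: "\<zeta> \<noteq> 1" using \<zeta>(2) n by (metis less_trans one_less_numeral_iff power_one_right semiring_norm(76) zero_less_one)
  obtain H G where H: "\<And>d i. i < n \<Longrightarrow> graded d (axis i) (H d i)"
    and G: "\<And>d i. i < n \<Longrightarrow> graded d (axis i) (G d i)"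
    and res: "\<And>d i. i < n \<Longrightarrow> \<forall>\<alpha>\<in>Poly_Mapping.keys (G d i). eigenvalue n \<zeta> \<alpha> = \<zeta> ^ i"
    and HG: "transforms_to n l \<zeta> p H G"
    using graded_normal_form_exists [OF generator_in_rat_adjoin] p_range p_sum by blast
  have hom: "is_yhom n l d (H d i)" "is_yhom n l d (G d i)" if "i < n" for d i
    using graded_imp_is_yhom [OF H [OF that]] graded_imp_is_yhom [OF G [OF that]] .
  show ?thesis
  proof (intro exI [of _ G] conjI allI impI)
    show "is_PD_normal_form n l \<zeta> p G"
      unfolding is_PD_normal_form_def
      using hom HG res by (auto simp: eigenvalue_def)
  next
    fix d :: nat
    have "\<forall>i\<in>{..<n}. \<exists>q. q \<in> R (rat_adjoin \<zeta>) n l p (\<lambda>_. int ((d - 1) div n)) \<and>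
        G d i = (\<Prod>j<n. yvar j ^ ((d - 1) div n)) * (yvar i * yconst q)"
      using resonant_graded_form [OF n(1) \<zeta>(1) \<zeta>1 _ G res] by blast
    then obtain q where "\<forall>i\<in>{..<n}. q i \<in> R (rat_adjoin \<zeta>) n l p (\<lambda>_. int ((d - 1) div n)) \<and>
        G d i = (\<Prod>j<n. yvar j ^ ((d - 1) div n)) * (yvar i * yconst (q i))"
      by (metis bchoice)
    then show "\<exists>K q. (\<forall>i<n. q i \<in> R (rat_adjoin \<zeta>) n l p (\<lambda>_. int K)) \<and>
        (\<forall>i<n. G d i = (\<Prod>j<n. yvar j ^ K) * (yvar i * yconst (q i)))"
      by (intro exI [of _ "(d - 1) div n"] exI [of _ q]) auto
  qed
qed

end
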